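(* Let $\Pi^+=\{z:\operatorname{Im}z>0\}$ and $\bar\Pi^+$ its closure. Let $\gamma,\gamma':(0,1)\to\Pi^+$ be continuous paths with endpoints $\gamma(0)=a_1+ib_1$, $\gamma(1)=a_2+ib_2$, $\gamma'(0)=a_1'+ib_1'$, $\gamma'(1)=a_2'+ib_2'$ in $\bar\Pi^+$, i.e. $b_1,b_2,b_1',b_2'\ge0$. Then for every $\alpha\in(0,1)$, $\alpha\ne\frac12$: 1. The double integral $$I_{\gamma,\gamma'}=\int_\gamma du\int_{\bar\gamma'}d\bar v\,(-i(u-\bar v))^{2\alpha-2}$$ is well defined. It depends only on the homology class of the paths $\gamma,\gamma'$, in other words only on the endpoints $\gamma(0),\gamma'(0),\gamma(1),\gamma'(1)$. Furthermore, it is invariant under real translations $\gamma\to\gamma+a$, $\gamma'\to\gamma'+a$ ($a\in\mathbb{R}$). 2. Suppose $a_1=a_1'=0$ and let $b_1,b_2,b_1',b_2'\to0$. Then $$I_{\gamma,\gamma'}\to\frac{e^{i\pi\alpha\,\mathrm{sgn}(a_2'-a_2)}|a_2'-a_2|^{2\alpha}-e^{-i\pi\alpha\,\mathrm{sgn}(a_2)}|a_2|^{2\alpha}-e^{i\pi\alpha\,\mathrm{sgn}(a_2')}|a_2'|^{2\alpha}}{2\alpha(2\alpha-1)}.$$ Hence $$I_{\gamma,\gamma'}+\overline{I_{\gamma,\gamma'}}=2\operatorname{Re}I_{\gamma,\gamma'}\to\frac{2\cos\pi\alpha}{\alpha(1-2\alpha)}\cdot\frac{|a_2|^{2\alpha}+|a_2'|^{2\alpha}-|a_2'-a_2|^{2\alpha}}{2}.$$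 3. Suppose $\gamma=\gamma'$. Then there exists a constant $C>0$, not depending on $\gamma$, such that $$\left|\int_\gamma du\int_{\bar\gamma}d\bar v\,(-i(u-\bar v))^{2\alpha-2}\right|\le C|\gamma(1)-\gamma(0)|^{2\alpha}.$$
   Context: For $z\in\mathbb{C}\setminus\mathbb{R}_-$ and $\beta\in\mathbb{C}$, $z^\beta:=\exp(\beta\ln z)$ with the principal determination of the logarithm. $\mathrm{sgn}(x)=x/|x|$ for real $x\neq0$ (a term with $|x|^{2\alpha}$, $x=0$, is zero). $\bar\gamma'$ denotes the complex conjugate path of $\gamma'$, lying in the lower half-plane. *)

theory Defs
  imports "HOL-Complex_Analysis.Complex_Analysis"
begin

section \<open>Integrals of analytic functions along continuous paths\<close>

text \<open>
  The library's contour integral is only defined along piecewise \<open>C\<^sup>1\<close> paths. Along a path that is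
  merely continuous, the integral of an analytic function is the common value of its contour
  integrals along all piecewise \<open>C\<^sup>1\<close> paths with the same endpoints that are uniformly close to
  the given one (the library's winding numbers of continuous paths are defined in the same spirit).
\<close>

definition has_continuous_contour_integral ::
    "(complex \<Rightarrow> complex) \<Rightarrow> complex \<Rightarrow> (real \<Rightarrow> complex) \<Rightarrow> bool" where
  "has_continuous_contour_integral f I g \<longleftrightarrow>
     (\<exists>d>0. \<forall>p. valid_path p \<and> pathstart p = pathstart g \<and> pathfinish p = pathfinish g \<and>
               (\<forall>t\<in>{0..1}. dist (p t) (g t) < d) \<longrightarrow> (f has_contour_integral I) p)"

lemma has_continuous_contour_integral_valid_path:
  assumes "valid_path g" "has_continuous_contour_integral f I g"
  shows "(f has_contour_integral I) g"
proof -
  obtain d where "d > 0"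
    "\<forall>p. valid_path p \<and> pathstart p = pathstart g \<and> pathfinish p = pathfinish g \<and>
         (\<forall>t\<in>{0..1}. dist (p t) (g t) < d) \<longrightarrow> (f has_contour_integral I) p"
    using assms(2) unfolding has_continuous_contour_integral_def by (elim exE conjE) (rule that)
  with assms(1) show ?thesis
    by simp
qed

lemma has_continuous_contour_integral_unique:
  assumes "path g" "has_continuous_contour_integral f I g" "has_continuous_contour_integral f J g"
  shows "I = J"
proof -
  obtain d where d: "d > 0"
    "\<forall>p. valid_path p \<and> pathstart p = pathstart g \<and> pathfinish p = pathfinish g \<and>
         (\<forall>t\<in>{0..1}. dist (p t) (g t) < d) \<longrightarrow> (f has_contour_integral I) p"
    using assms(2) unfolding has_continuous_contour_integral_def by (elim exE conjE) (rule that)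
  obtain e where e: "e > 0"
    "\<forall>p. valid_path p \<and> pathstart p = pathstart g \<and> pathfinish p = pathfinish g \<and>
         (\<forall>t\<in>{0..1}. dist (p t) (g t) < e) \<longrightarrow> (f has_contour_integral J) p"
    using assms(3) unfolding has_continuous_contour_integral_def by (elim exE conjE) (rule that)
  have pos: "min d e > 0"
    using d(1) e(1) by simp
  obtain p where p: "polynomial_function p" "pathstart p = pathstart g" "pathfinish p = pathfinish g"
    "\<And>t. t \<in> {0..1} \<Longrightarrow> norm (p t - g t) < min d e"
    using path_approx_polynomial_function[OF assms(1) pos] by metis
  have "valid_path p"
    using p(1) by (rule valid_path_polynomial_function)
  moreover have "\<forall>t\<in>{0..1}. dist (p t) (g t) < d" "\<forall>t\<in>{0..1}. dist (p t) (g t) < e"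
    using p(4) by (simp_all add: dist_norm)
  ultimately have "(f has_contour_integral I) p" "(f has_contour_integral J) p"
    using d(2)[rule_format, of p] e(2)[rule_format, of p] p(2,3) by simp_all
  then show ?thesis
    by (rule has_contour_integral_unique)
qed

lemma has_continuous_contour_integral_exists:
  assumes "open S" "f holomorphic_on S" "path g" "path_image g \<subseteq> S"
  obtains I where "has_continuous_contour_integral f I g"
proof -
  obtain d where d: "d > 0"
    "\<forall>p q. valid_path p \<and> valid_path q \<and>
         (\<forall>t\<in>{0..1}. norm (p t - g t) < d \<and> norm (q t - g t) < d) \<and>
         pathstart q = pathstart p \<and> pathfinish q = pathfinish p \<longrightarrow>
         path_image p \<subseteq> S \<and> path_image q \<subseteq> S \<and>
         (\<forall>f. f holomorphic_on S \<longrightarrow> contour_integral q f = contour_integral p f)"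
    using contour_integral_nearby_ends[OF assms(1,3,4)] by (elim exE conjE) (rule that)
  obtain q where q: "polynomial_function q" "pathstart q = pathstart g" "pathfinish q = pathfinish g"
    "\<And>t. t \<in> {0..1} \<Longrightarrow> norm (q t - g t) < d"
    using path_approx_polynomial_function[OF assms(3) d(1)] by metis
  have vq: "valid_path q"
    using q(1) by (rule valid_path_polynomial_function)
  have "(f has_contour_integral (contour_integral q f)) p"
    if "valid_path p" "pathstart p = pathstart g" "pathfinish p = pathfinish g"
       "\<forall>t\<in>{0..1}. dist (p t) (g t) < d" for p
  proof -
    have "\<forall>t\<in>{0..1}. norm (p t - g t) < d \<and> norm (q t - g t) < d"
      using that(4) q(4) by (simp add: dist_norm)
    then have "path_image p \<subseteq> S" "contour_integral q f = contour_integral p f"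
      using d(2)[rule_format, of p q] that(1-3) vq q(2,3) assms(2) by simp_all
    moreover have "f contour_integrable_on p"
      using contour_integrable_holomorphic_simple[OF assms(2,1) that(1)] \<open>path_image p \<subseteq> S\<close> by simp
    ultimately show ?thesis
      using has_contour_integral_integral by simp
  qed
  then have "has_continuous_contour_integral f (contour_integral q f) g"
    unfolding has_continuous_contour_integral_def by (intro exI[of _ d]) (simp add: d(1))
  then show thesis
    by (rule that)
qed

text \<open>
  If the endpoints of the path may be singularities of the integrand, the integral is improper: the
  parameter interval is \<open>]0,1[\<close>, exhausted by the intervals \<open>[s,t]\<close>.
\<close>

definition has_path_integral ::
    "(complex \<Rightarrow> complex) \<Rightarrow> complex \<Rightarrow> (real \<Rightarrow> complex) \<Rightarrow> bool" where
  "has_path_integral f I g \<longleftrightarrow>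
     (\<exists>J. (\<forall>s t. 0 < s \<and> s < t \<and> t < 1 \<longrightarrow>
              has_continuous_contour_integral f (J s t) (subpath s t g)) \<and>
          ((\<lambda>(s, t). J s t) \<longlongrightarrow> I) (at_right 0 \<times>\<^sub>F at_left 1))"

definition path_integral :: "(real \<Rightarrow> complex) \<Rightarrow> (complex \<Rightarrow> complex) \<Rightarrow> complex" where
  "path_integral g f = (THE I. has_path_integral f I g)"


section \<open>Paths in the upper half-plane and the double integral\<close>

definition upper_half_plane :: "complex set" where
  "upper_half_plane = {z. Im z > 0}"

definition upper_path :: "(real \<Rightarrow> complex) \<Rightarrow> bool" where
  "upper_path \<gamma> \<longleftrightarrow> path \<gamma> \<and> \<gamma> ` {0<..<1} \<subseteq> upper_half_plane \<and>
     pathstart \<gamma> \<in> closure upper_half_plane \<and> pathfinish \<gamma> \<in> closure upper_half_plane"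

text \<open>In the kernel, \<open>w\<close> stands for the complex conjugate of the variable \<open>v\<close>.\<close>

definition kernel :: "real \<Rightarrow> complex \<Rightarrow> complex \<Rightarrow> complex" where
  "kernel \<alpha> u w = (- \<i> * (u - w)) powr of_real (2 * \<alpha> - 2)"

definition inner_integral :: "real \<Rightarrow> (real \<Rightarrow> complex) \<Rightarrow> complex \<Rightarrow> complex" where
  "inner_integral \<alpha> \<gamma>' u = path_integral (cnj \<circ> \<gamma>') (kernel \<alpha> u)"

definition double_integral :: "real \<Rightarrow> (real \<Rightarrow> complex) \<Rightarrow> (real \<Rightarrow> complex) \<Rightarrow> complex" where
  "double_integral \<alpha> \<gamma> \<gamma>' = path_integral \<gamma> (inner_integral \<alpha> \<gamma>')"

text \<open>
  The inner integral has to exist at every point of the open half-plane, not just on \<open>\<gamma>\<close>, since the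
  outer integral is taken along paths approximating \<open>\<gamma>\<close>.
\<close>

definition double_integral_well_defined ::
    "real \<Rightarrow> (real \<Rightarrow> complex) \<Rightarrow> (real \<Rightarrow> complex) \<Rightarrow> bool" where
  "double_integral_well_defined \<alpha> \<gamma> \<gamma>' \<longleftrightarrow>
     (\<forall>u\<in>upper_half_plane. \<exists>!J. has_path_integral (kernel \<alpha> u) J (cnj \<circ> \<gamma>')) \<and>
     (\<exists>!I. has_path_integral (inner_integral \<alpha> \<gamma>') I \<gamma>)"

text \<open>
  The filter on pairs of paths from \<open>i b\<^sub>1\<close> to \<open>a + i b\<^sub>2\<close> and from \<open>i b\<^sub>1'\<close> to \<open>a' + i b\<^sub>2'\<close>,
  respectively, as the four heights tend to \<open>0\<close> (some or all of them may be equal to \<open>0\<close>).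
\<close>

definition heights_to_zero :: "real \<Rightarrow> real \<Rightarrow> ((real \<Rightarrow> complex) \<times> (real \<Rightarrow> complex)) filter" where
  "heights_to_zero a a' =
     inf (principal {(\<gamma>, \<gamma>'). upper_path \<gamma> \<and> upper_path \<gamma>' \<and>
            Re (pathstart \<gamma>) = 0 \<and> Re (pathfinish \<gamma>) = a \<and>
            Re (pathstart \<gamma>') = 0 \<and> Re (pathfinish \<gamma>') = a'})
         (filtercomap (\<lambda>(\<gamma>, \<gamma>'). (Im (pathstart \<gamma>), Im (pathfinish \<gamma>),
                                Im (pathstart \<gamma>'), Im (pathfinish \<gamma>')))
            (nhds (0, 0, 0, 0)))"

end

theory Submission
  imports Defs
begin

text \<open>
  For \<open>u\<close> in the open upper and \<open>w\<close> in the closed lower half-plane, \<open>- \<i> * (u - w)\<close> lies in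
  the open right half-plane. There the powers are holomorphic, so the kernel can be
  integrated explicitly. With
  \<open>G z = (- \<i> * z) powr (2 * \<alpha>) / (2 * \<alpha> * (2 * \<alpha> - 1))\<close> one has \<open>G'' = - kernel\<close>; hence \<open>w \<mapsto> G' (u - w)\<close>
  is a primitive of the kernel, and \<open>u \<mapsto> G (u - w)\<close> is in turn a primitive of \<open>u \<mapsto> G' (u - w)\<close>. The double
  integral is therefore the mixed difference
  \<open>G (u\<^sub>1 - w\<^sub>1) - G (u\<^sub>1 - w\<^sub>0) - G (u\<^sub>0 - w\<^sub>1) + G (u\<^sub>0 - w\<^sub>0)\<close>
  of \<open>G\<close> over the endpoints \<open>u\<^sub>0, u\<^sub>1\<close> of \<open>\<gamma>\<close> and \<open>w\<^sub>0, w\<^sub>1\<close> of the conjugate of \<open>\<gamma>'\<close>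
  (\<open>double_integral_closed_form\<close>). As \<open>2 * \<alpha> > 0\<close>, the function \<open>G\<close> is continuous up to
  the real axis, including at \<open>0\<close>; this makes the improper integrals converge and also gives
  the limit as the heights tend to \<open>0\<close>. Path independence and translation invariance can be read off.

  For \<open>\<gamma> = \<gamma>'\<close> with endpoints at heights \<open>b, d\<close>, put \<open>m = b + d\<close> and let \<open>x\<close> be the
  difference of the real parts. The mixed difference then is a constant multiple of the difference of two symmetric second
  differences of the power function at the real point \<open>m\<close>, with
  increments \<open>d - b\<close> and \<open>\<i> * x\<close>, neither longer than the distance \<open>h\<close> of the endpoints. If \<open>m \<ge> 2 * h\<close>,
  Taylor's formula bounds it by a multiple of \<open>h\<^sup>2 * m powr (2 * \<alpha> - 2) \<le> h powr (2 * \<alpha>)\<close>;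
  if \<open>m < 2 * h\<close>, each single term is already \<open>O(h powr (2 * \<alpha>))\<close>.
\<close>

section \<open>Path integrals by primitives\<close>

text \<open>
  Paths close enough to a path in an open set stay in this set, because the image of the path is
  compact; on such paths the fundamental theorem of calculus applies.
\<close>

lemma has_continuous_contour_integral_primitive:
  assumes "open S" and prim: "\<And>z. z \<in> S \<Longrightarrow> (F has_field_derivative f z) (at z)"
    and "path g" "path_image g \<subseteq> S"
  shows "has_continuous_contour_integral f (F (pathfinish g) - F (pathstart g)) g"
proof -
  obtain d where d: "d > 0" "(\<Union>z\<in>path_image g. ball z d) \<subseteq> S"
    using compact_subset_open_imp_ball_epsilon_subset[OF compact_path_image] assms by metis
  have "(f has_contour_integral (F (pathfinish g) - F (pathstart g))) p"
    if p: "valid_path p" "pathstart p = pathstart g" "pathfinish p = pathfinish g"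
      "\<forall>t\<in>{0..1}. dist (p t) (g t) < d" for p
  proof -
    have "p t \<in> S" if "t \<in> {0..1}" for t
    proof -
      have "p t \<in> ball (g t) d"
        using p(4) that by (simp add: dist_commute)
      moreover have "g t \<in> path_image g"
        using that by (simp add: path_image_def)
      ultimately show ?thesis
        using d(2) by blast
    qed
    then have "path_image p \<subseteq> S"
      by (auto simp: path_image_def)
    then show ?thesis
      using contour_integral_primitive[of S F f p] prim has_field_derivative_at_within p by metis
  qed
  then show ?thesis
    unfolding has_continuous_contour_integral_def using d(1) by blast
qed

lemma eventually_exhausting_intervals:
  "eventually (\<lambda>(s, t). 0 < s \<and> s < t \<and> t < (1::real)) (at_right 0 \<times>\<^sub>F at_left 1)"
proof -
  have "eventually (\<lambda>s::real. s \<in> {0<..<1/2}) (at_right 0)"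
    by (rule eventually_at_right_real) simp
  moreover have "eventually (\<lambda>t::real. t \<in> {1/2<..<1}) (at_left 1)"
    by (rule eventually_at_left_real) simp
  ultimately have "eventually (\<lambda>p. fst p \<in> {0<..<1/2} \<and> snd p \<in> {1/2<..<(1::real)})
      (at_right (0::real) \<times>\<^sub>F at_left 1)"
    unfolding eventually_prod_filter by (metis fst_conv snd_conv)
  then show ?thesis
    by eventually_elim (auto simp: case_prod_beta)
qed

text \<open>
  The integrals over the parameter intervals \<open>[s, t]\<close> with \<open>0 < s < t < 1\<close> are unique, and these
  pairs \<open>(s, t)\<close> form an eventual set of a nontrivial filter; so their limit is unique too.
\<close>

lemma has_path_integral_unique:
  assumes "path g" "has_path_integral f I g" "has_path_integral f K g"
  shows "I = K"
proof -
  obtain J where J: "\<And>s t. 0 < s \<and> s < t \<and> t < 1 \<Longrightarrow>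
      has_continuous_contour_integral f (J s t) (subpath s t g)"
    "((\<lambda>(s, t). J s t) \<longlongrightarrow> I) (at_right 0 \<times>\<^sub>F at_left 1)"
    using assms(2) unfolding has_path_integral_def by blast
  obtain L where L: "\<And>s t. 0 < s \<and> s < t \<and> t < 1 \<Longrightarrow>
      has_continuous_contour_integral f (L s t) (subpath s t g)"
    "((\<lambda>(s, t). L s t) \<longlongrightarrow> K) (at_right 0 \<times>\<^sub>F at_left 1)"
    using assms(3) unfolding has_path_integral_def by blast
  have "J s t = L s t" if "0 < s \<and> s < t \<and> t < 1" for s t
  proof (rule has_continuous_contour_integral_unique)
    show "path (subpath s t g)"
      using assms(1) that by (intro path_subpath) auto
  qed (use J(1) L(1) that in auto)
  then have "eventually (\<lambda>p. (case p of (s, t) \<Rightarrow> L s t) = (case p of (s, t) \<Rightarrow> J s t))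
      (at_right 0 \<times>\<^sub>F at_left 1)"
    using eventually_exhausting_intervals by (auto elim: eventually_mono)
  with L(2) have "((\<lambda>(s, t). J s t) \<longlongrightarrow> K) (at_right 0 \<times>\<^sub>F at_left 1)"
    by (rule Lim_transform_eventually)
  moreover have "at_right (0::real) \<times>\<^sub>F at_left (1::real) \<noteq> bot"
    by (simp add: prod_filter_eq_bot)
  ultimately show ?thesis
    using J(2) tendsto_unique by metis
qed

lemma path_integral_eqI:
  assumes "path g" "has_path_integral f I g"
  shows "path_integral g f = I"
  unfolding path_integral_def using assms has_path_integral_unique by blast

text \<open>
  The primitive has to be continuous at the two endpoints, but they may lie on the boundary of the
  domain on which it is one.
\<close>

lemma has_path_integral_primitive:
  assumes "open S" and prim: "\<And>z. z \<in> S \<Longrightarrow> (F has_field_derivative f z) (at z)"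
    and g: "path g" "g ` {0<..<1} \<subseteq> S"
    and cont: "isCont F (pathstart g)" "isCont F (pathfinish g)"
  shows "has_path_integral f (F (pathfinish g) - F (pathstart g)) g"
proof -
  have *: "has_continuous_contour_integral f (F (g t) - F (g s)) (subpath s t g)"
    if st: "0 < s" "s < t" "t < 1" for s t
  proof -
    have "path (subpath s t g)"
      using g(1) st by (intro path_subpath) auto
    moreover have "path_image (subpath s t g) \<subseteq> S"
      using g(2) st by (force simp: path_image_subpath)
    ultimately show ?thesis
      using has_continuous_contour_integral_primitive[OF assms(1) prim] by fastforce
  qed
  have c: "continuous_on {0..1} g"
    using g(1) by (simp add: path_def)
  have "((\<lambda>s. F (g s)) \<longlongrightarrow> F (pathstart g)) (at_right 0)"
    using isCont_tendsto_compose[OF cont(1)] continuous_on_Icc_at_rightD[OF c]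
    by (simp add: pathstart_def)
  moreover have "((\<lambda>t. F (g t)) \<longlongrightarrow> F (pathfinish g)) (at_left 1)"
    using isCont_tendsto_compose[OF cont(2)] continuous_on_Icc_at_leftD[OF c]
    by (simp add: pathfinish_def)
  ultimately have "((\<lambda>p. F (g (snd p)) - F (g (fst p))) \<longlongrightarrow> F (pathfinish g) - F (pathstart g))
      (at_right 0 \<times>\<^sub>F at_left 1)"
    by (intro tendsto_diff; elim filterlim_compose) (rule filterlim_snd filterlim_fst)+
  then show ?thesis
    unfolding has_path_integral_def using *
    by (intro exI[of _ "\<lambda>s t. F (g t) - F (g s)"]) (auto simp: case_prod_unfold)
qed


section \<open>The closed form of the double integral\<close>

text \<open>
  These are \<open>G'\<close> and \<open>G\<close> for \<open>G'' z = - ((- \<i> * z) powr (2 * \<alpha> - 2))\<close>. The negative sign is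
  compensated when \<open>G' (u - w)\<close> is differentiated with respect to \<open>w\<close>.
\<close>

definition kernel_primitive :: "real \<Rightarrow> complex \<Rightarrow> complex" where
  "kernel_primitive \<alpha> z = - \<i> * (- \<i> * z) powr of_real (2 * \<alpha> - 1) / of_real (2 * \<alpha> - 1)"

definition kernel_primitive2 :: "real \<Rightarrow> complex \<Rightarrow> complex" where
  "kernel_primitive2 \<alpha> z =
     (- \<i> * z) powr of_real (2 * \<alpha>) / of_real (2 * \<alpha> * (2 * \<alpha> - 1))"

lemma closure_upper_half_plane: "closure upper_half_plane = {z. Im z \<ge> 0}"
proof -
  have "closure {z. \<i> \<bullet> z > 0} = {z. \<i> \<bullet> z \<ge> 0}"
    by (rule closure_halfspace_gt) simp
  then show ?thesis
    by (simp add: upper_half_plane_def inner_complex_def)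
qed

lemma open_upper_half_plane: "open upper_half_plane"
  unfolding upper_half_plane_def by (rule open_halfspace_Im_gt)

lemma upper_pathD:
  assumes "upper_path \<gamma>"
  shows "path \<gamma>" "\<And>t. 0 < t \<Longrightarrow> t < 1 \<Longrightarrow> Im (\<gamma> t) > 0"
    "Im (pathstart \<gamma>) \<ge> 0" "Im (pathfinish \<gamma>) \<ge> 0"
  using assms unfolding upper_path_def closure_upper_half_plane
  by (auto simp: image_subset_iff upper_half_plane_def)

lemma rotated_not_nonpos_Reals: "Im z > 0 \<Longrightarrow> - \<i> * z \<notin> \<real>\<^sub>\<le>\<^sub>0"
  by (auto simp: complex_nonpos_Reals_iff)

lemma kernel_primitive_deriv:
  assumes "\<alpha> \<noteq> 1/2" "Im u > Im w"
  shows "((\<lambda>w. kernel_primitive \<alpha> (u - w)) has_field_derivative kernel \<alpha> u w) (at w)"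
proof -
  have nz: "complex_of_real (2 * \<alpha> - 1) \<noteq> 0"
    using assms(1) by (simp only: of_real_eq_0_iff)
  have "((\<lambda>w. (- \<i> * (u - w)) powr of_real (2 * \<alpha> - 1)) has_field_derivative
      of_real (2 * \<alpha> - 1) * (- \<i> * (u - w)) powr (of_real (2 * \<alpha> - 1) - 1) * \<i>) (at w)"
    using rotated_not_nonpos_Reals[of "u - w"] assms(2)
    by (intro DERIV_chain2[OF has_field_derivative_powr]) (auto intro!: derivative_eq_intros)
  then have "((\<lambda>w. kernel_primitive \<alpha> (u - w)) has_field_derivative
      - \<i> * (of_real (2 * \<alpha> - 1) * (- \<i> * (u - w)) powr (of_real (2 * \<alpha> - 1) - 1) * \<i>)
        / of_real (2 * \<alpha> - 1)) (at w)"
    unfolding kernel_primitive_def by (intro DERIV_cdivide DERIV_cmult)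
  moreover have "- \<i> * (of_real (2 * \<alpha> - 1) * (- \<i> * (u - w)) powr (of_real (2 * \<alpha> - 1) - 1) * \<i>)
        / of_real (2 * \<alpha> - 1) = (- \<i> * (u - w)) powr (of_real (2 * \<alpha> - 1) - 1)"
    using nz by (simp add: field_simps)
  moreover have "complex_of_real (2 * \<alpha> - 1) - 1 = of_real (2 * \<alpha> - 2)"
    by simp
  ultimately show ?thesis
    unfolding kernel_def by metis
qed

lemma kernel_primitive2_deriv:
  assumes "\<alpha> \<noteq> 0" "\<alpha> \<noteq> 1/2" "Im u > Im w"
  shows "((\<lambda>u. kernel_primitive2 \<alpha> (u - w)) has_field_derivative kernel_primitive \<alpha> (u - w)) (at u)"
proof -
  have nz: "complex_of_real (2 * \<alpha>) \<noteq> 0" "complex_of_real (2 * \<alpha> - 1) \<noteq> 0"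
    using assms(1,2) by (simp_all only: of_real_eq_0_iff)
  have "((\<lambda>u. (- \<i> * (u - w)) powr of_real (2 * \<alpha>)) has_field_derivative
      of_real (2 * \<alpha>) * (- \<i> * (u - w)) powr (of_real (2 * \<alpha>) - 1) * (- \<i>)) (at u)"
    using rotated_not_nonpos_Reals[of "u - w"] assms(3)
    by (intro DERIV_chain2[OF has_field_derivative_powr]) (auto intro!: derivative_eq_intros)
  then have "((\<lambda>u. kernel_primitive2 \<alpha> (u - w)) has_field_derivative
      of_real (2 * \<alpha>) * (- \<i> * (u - w)) powr (of_real (2 * \<alpha>) - 1) * (- \<i>)
        / of_real (2 * \<alpha> * (2 * \<alpha> - 1))) (at u)"
    unfolding kernel_primitive2_def by (rule DERIV_cdivide)
  moreover have "of_real (2 * \<alpha>) * (- \<i> * (u - w)) powr (of_real (2 * \<alpha>) - 1) * (- \<i>)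
        / of_real (2 * \<alpha> * (2 * \<alpha> - 1)) = kernel_primitive \<alpha> (u - w)"
    unfolding kernel_primitive_def of_real_mult[of "2 * \<alpha>"] of_real_diff of_real_1
    using nz by (simp add: field_simps)
  ultimately show ?thesis
    by metis
qed

text \<open>
  At the branch point \<open>0\<close>, continuity follows from the positivity of the exponent.
\<close>

lemma isCont_kernel_primitive2:
  assumes "\<alpha> > 0" "Im z \<ge> 0"
  shows "isCont (kernel_primitive2 \<alpha>) z"
proof -
  have "- \<i> * z \<notin> \<real>\<^sub>\<le>\<^sub>0 \<or> (- \<i> * z = 0 \<and> Re (of_real (2 * \<alpha>)) > 0)"
    using assms by (auto simp: complex_nonpos_Reals_iff complex_eq_iff)
  then have "((\<lambda>z. (- \<i> * z) powr of_real (2 * \<alpha>)) \<longlongrightarrow> (- \<i> * z) powr of_real (2 * \<alpha>)) (at z)"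
    by (intro tendsto_powr_complex' tendsto_intros) auto
  then show ?thesis
    unfolding isCont_def kernel_primitive2_def divide_inverse by (rule tendsto_mult_right)
qed

lemma path_cnj: "path \<gamma> \<Longrightarrow> path (cnj \<circ> \<gamma>)"
  unfolding path_def by (intro continuous_on_compose continuous_intros)

text \<open>
  For \<open>u\<close> in the open half-plane the kernel is regular on the whole half-plane below \<open>u\<close>, which
  contains the conjugate path with its endpoints, so this integral is improper in form only.
\<close>

lemma has_path_integral_kernel:
  assumes "\<alpha> \<noteq> 1/2" "upper_path \<gamma>'" "Im u > 0"
  shows "has_path_integral (kernel \<alpha> u)
     (kernel_primitive \<alpha> (u - cnj (pathfinish \<gamma>')) - kernel_primitive \<alpha> (u - cnj (pathstart \<gamma>')))
     (cnj \<circ> \<gamma>')"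
proof -
  let ?F = "\<lambda>w. kernel_primitive \<alpha> (u - w)"
  note \<gamma>' = upper_pathD[OF assms(2)]
  have deriv: "(?F has_field_derivative kernel \<alpha> u w) (at w)" if "w \<in> {w. Im w < Im u}" for w
    using kernel_primitive_deriv[OF assms(1), of w u] that by simp
  have "has_path_integral (kernel \<alpha> u) (?F (pathfinish (cnj \<circ> \<gamma>')) - ?F (pathstart (cnj \<circ> \<gamma>')))
      (cnj \<circ> \<gamma>')"
  proof (rule has_path_integral_primitive[OF open_halfspace_Im_lt deriv])
    show "path (cnj \<circ> \<gamma>')"
      using \<gamma>'(1) by (rule path_cnj)
    show "(cnj \<circ> \<gamma>') ` {0<..<1} \<subseteq> {w. Im w < Im u}"
      using \<gamma>'(2) assms(3) by force
    show "isCont ?F (pathstart (cnj \<circ> \<gamma>'))" "isCont ?F (pathfinish (cnj \<circ> \<gamma>'))"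
      using \<gamma>'(3,4) assms(3) by (auto intro!: DERIV_isCont[OF deriv] simp: pathstart_compose
          pathfinish_compose)
  qed
  then show ?thesis
    by (simp add: pathstart_compose pathfinish_compose)
qed

lemma inner_integral_eq:
  assumes "\<alpha> \<noteq> 1/2" "upper_path \<gamma>'" "Im u > 0"
  shows "inner_integral \<alpha> \<gamma>' u =
     kernel_primitive \<alpha> (u - cnj (pathfinish \<gamma>')) - kernel_primitive \<alpha> (u - cnj (pathstart \<gamma>'))"
  unfolding inner_integral_def
  by (rule path_integral_eqI[OF path_cnj has_path_integral_kernel])
    (use assms upper_pathD(1) in auto)

definition mixed_difference :: "(complex \<Rightarrow> complex) \<Rightarrow> complex \<Rightarrow> complex \<Rightarrow> complex \<Rightarrow> complex \<Rightarrow> complex"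
  where "mixed_difference G u0 u1 w0 w1 = G (u1 - w1) - G (u1 - w0) - G (u0 - w1) + G (u0 - w0)"

text \<open>
  Here the integral may really be improper: if \<open>\<gamma>\<close> and \<open>\<gamma>'\<close> share a real endpoint, then \<open>u - w\<close>
  tends to \<open>0\<close> at it. The primitive is still continuous there.
\<close>

lemma has_path_integral_inner_integral:
  assumes "\<alpha> > 0" "\<alpha> \<noteq> 1/2" "upper_path \<gamma>" "upper_path \<gamma>'"
  shows "has_path_integral (inner_integral \<alpha> \<gamma>')
     (mixed_difference (kernel_primitive2 \<alpha>) (pathstart \<gamma>) (pathfinish \<gamma>)
        (cnj (pathstart \<gamma>')) (cnj (pathfinish \<gamma>'))) \<gamma>"
proof -
  note \<gamma> = upper_pathD[OF assms(3)] and \<gamma>' = upper_pathD[OF assms(4)]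
  let ?w0 = "cnj (pathstart \<gamma>')" and ?w1 = "cnj (pathfinish \<gamma>')"
  let ?H = "\<lambda>u. kernel_primitive2 \<alpha> (u - ?w1) - kernel_primitive2 \<alpha> (u - ?w0)"
  have cont: "isCont ?H u" if "Im u \<ge> 0" for u
    using that \<gamma>'(3,4)
    by (intro continuous_intros isCont_o2[OF _ isCont_kernel_primitive2[OF assms(1)]]) auto
  have "has_path_integral (inner_integral \<alpha> \<gamma>') (?H (pathfinish \<gamma>) - ?H (pathstart \<gamma>)) \<gamma>"
  proof (rule has_path_integral_primitive[OF open_upper_half_plane])
    fix u assume "u \<in> upper_half_plane"
    then have u: "Im u > 0"
      by (simp add: upper_half_plane_def)
    then show "(?H has_field_derivative inner_integral \<alpha> \<gamma>' u) (at u)"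
      unfolding inner_integral_eq[OF assms(2,4) u] using assms(1,2) \<gamma>'(3,4)
      by (intro DERIV_diff kernel_primitive2_deriv) auto
  qed (use \<gamma> cont in \<open>auto simp: upper_half_plane_def\<close>)
  then show ?thesis
    by (simp add: mixed_difference_def algebra_simps)
qed

lemma double_integral_well_definedI:
  assumes "\<alpha> > 0" "\<alpha> \<noteq> 1/2" "upper_path \<gamma>" "upper_path \<gamma>'"
  shows "double_integral_well_defined \<alpha> \<gamma> \<gamma>'"
  unfolding double_integral_well_defined_def upper_half_plane_def
  using has_path_integral_kernel[OF assms(2,4)] has_path_integral_inner_integral[OF assms]
    has_path_integral_unique upper_pathD(1) path_cnj assms(3,4)
  by (metis (mono_tags, lifting) mem_Collect_eq)

theorem double_integral_closed_form:
  assumes "\<alpha> > 0" "\<alpha> \<noteq> 1/2" "upper_path \<gamma>" "upper_path \<gamma>'"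
  shows "double_integral \<alpha> \<gamma> \<gamma>' =
     mixed_difference (kernel_primitive2 \<alpha>) (pathstart \<gamma>) (pathfinish \<gamma>)
       (cnj (pathstart \<gamma>')) (cnj (pathfinish \<gamma>'))"
  unfolding double_integral_def
  by (rule path_integral_eqI[OF upper_pathD(1) has_path_integral_inner_integral])
    (use assms in auto)

lemma upper_path_translate:
  assumes "upper_path \<gamma>"
  shows "upper_path (\<lambda>t. \<gamma> t + of_real a)"
  using assms unfolding upper_path_def closure_upper_half_plane
  by (auto simp: upper_half_plane_def path_def pathstart_def pathfinish_def intro!: continuous_intros)


section \<open>The limit for vanishing heights\<close>

text \<open>
  For real \<open>x \<noteq> 0\<close> the number \<open>- \<i> * x\<close> lies on the imaginary axis, with argument
  \<open>- pi / 2 * sgn x\<close>; this is the origin of the phases in the limit.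
\<close>

lemma kernel_primitive2_of_real:
  "kernel_primitive2 \<alpha> (of_real x) =
     exp (- \<i> * of_real (pi * \<alpha> * sgn x)) * of_real (\<bar>x\<bar> powr (2 * \<alpha>)) / of_real (2 * \<alpha> * (2 * \<alpha> - 1))"
proof (cases "x = 0")
  case False
  have "Ln (- \<i> * of_real x) = of_real (ln \<bar>x\<bar>) - \<i> * of_real (pi / 2 * sgn x)"
  proof (rule Ln_unique)
    have "exp (- (\<i> * of_real (pi / 2 * sgn x))) = - \<i> * of_real (sgn x)"
      using False by (cases "x > 0") (simp_all add: sgn_if exp_minus exp_eq_polar cis_conv_exp[symmetric])
    moreover have "exp (complex_of_real (ln \<bar>x\<bar>)) = of_real \<bar>x\<bar>"
      using False by (simp add: exp_of_real)
    ultimately show "exp (of_real (ln \<bar>x\<bar>) - \<i> * of_real (pi / 2 * sgn x)) = - \<i> * of_real x"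
      unfolding diff_conv_add_uminus exp_add using False by (cases "x > 0") auto
  next
    show "- pi < Im (of_real (ln \<bar>x\<bar>) - \<i> * of_real (pi / 2 * sgn x))"
      "Im (of_real (ln \<bar>x\<bar>) - \<i> * of_real (pi / 2 * sgn x)) \<le> pi"
      by (auto simp: sgn_if intro: order_trans[OF _ pi_ge_zero])
  qed
  then have "(- \<i> * of_real x) powr of_real (2 * \<alpha>) =
      exp (of_real (2 * \<alpha>) * (of_real (ln \<bar>x\<bar>) - \<i> * of_real (pi / 2 * sgn x)))"
    unfolding powr_def using False by (simp only:) simp
  also have "\<dots> = exp (- \<i> * of_real (pi * \<alpha> * sgn x)) * exp (of_real (2 * \<alpha> * ln \<bar>x\<bar>))"
    unfolding exp_add[symmetric] by (simp add: algebra_simps)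
  also have "exp (of_real (2 * \<alpha> * ln \<bar>x\<bar>)) = complex_of_real (\<bar>x\<bar> powr (2 * \<alpha>))"
    using False unfolding exp_of_real powr_def by simp
  finally have "(- \<i> * of_real x) powr of_real (2 * \<alpha>) =
      exp (- \<i> * of_real (pi * \<alpha> * sgn x)) * of_real (\<bar>x\<bar> powr (2 * \<alpha>))" .
  then show ?thesis
    by (simp add: kernel_primitive2_def)
qed (simp add: kernel_primitive2_def)

text \<open>
  The endpoints, and with them the arguments of \<open>kernel_primitive2\<close>, are continuous functions of
  the heights, so continuity of \<open>kernel_primitive2\<close> on the real axis suffices.
\<close>

lemma double_integral_limit:
  assumes "\<alpha> > 0" "\<alpha> \<noteq> 1/2"
  shows "((\<lambda>(\<gamma>, \<gamma>'). double_integral \<alpha> \<gamma> \<gamma>') \<longlongrightarrow>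
     mixed_difference (kernel_primitive2 \<alpha>) 0 (of_real a) 0 (of_real a')) (heights_to_zero a a')"
proof -
  let ?F = "heights_to_zero a a'"
  let ?S = "{(\<gamma>, \<gamma>'). upper_path \<gamma> \<and> upper_path \<gamma>' \<and>
            Re (pathstart \<gamma>) = 0 \<and> Re (pathfinish \<gamma>) = a \<and>
            Re (pathstart \<gamma>') = 0 \<and> Re (pathfinish \<gamma>') = a'}"
  let ?h = "\<lambda>(\<gamma>, \<gamma>'). (Im (pathstart \<gamma>), Im (pathfinish \<gamma>), Im (pathstart \<gamma>'), Im (pathfinish \<gamma>'))"
  have h: "(?h \<longlongrightarrow> (0, 0, 0, 0)) ?F"
    unfolding heights_to_zero_def by (rule filterlim_mono[OF filterlim_filtercomap order_refl inf_le2])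
  have h': "((\<lambda>p. Im (pathstart (fst p))) \<longlongrightarrow> 0) ?F" "((\<lambda>p. Im (pathfinish (fst p))) \<longlongrightarrow> 0) ?F"
    "((\<lambda>p. Im (pathstart (snd p))) \<longlongrightarrow> 0) ?F" "((\<lambda>p. Im (pathfinish (snd p))) \<longlongrightarrow> 0) ?F"
    using tendsto_fst[OF h] tendsto_fst[OF tendsto_snd[OF h]]
      tendsto_fst[OF tendsto_snd[OF tendsto_snd[OF h]]]
      tendsto_snd[OF tendsto_snd[OF tendsto_snd[OF h]]]
    by (simp_all add: case_prod_beta)
  have G: "((\<lambda>p. kernel_primitive2 \<alpha> (of_real x + \<i> * of_real (y p))) \<longlongrightarrow>
      kernel_primitive2 \<alpha> (of_real x)) ?F" if "(y \<longlongrightarrow> 0) ?F" for x y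
  proof (rule isCont_tendsto_compose[OF isCont_kernel_primitive2[OF assms(1)]])
    have "((\<lambda>p. of_real x + \<i> * of_real (y p)) \<longlongrightarrow> complex_of_real x + \<i> * of_real 0) ?F"
      by (intro tendsto_intros that)
    then show "((\<lambda>p. of_real x + \<i> * of_real (y p)) \<longlongrightarrow> complex_of_real x) ?F"
      by simp
  qed simp
  let ?b0 = "\<lambda>p. Im (pathstart (fst p))" and ?b1 = "\<lambda>p. Im (pathfinish (fst p))"
    and ?c0 = "\<lambda>p. Im (pathstart (snd p))" and ?c1 = "\<lambda>p. Im (pathfinish (snd p))"
  let ?D = "\<lambda>p. kernel_primitive2 \<alpha> (of_real (a - a') + \<i> * of_real (?b1 p + ?c1 p))
      - kernel_primitive2 \<alpha> (of_real a + \<i> * of_real (?b1 p + ?c0 p))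
      - kernel_primitive2 \<alpha> (of_real (- a') + \<i> * of_real (?b0 p + ?c1 p))
      + kernel_primitive2 \<alpha> (of_real 0 + \<i> * of_real (?b0 p + ?c0 p))"
  have "(?D \<longlongrightarrow> kernel_primitive2 \<alpha> (of_real (a - a')) - kernel_primitive2 \<alpha> (of_real a)
      - kernel_primitive2 \<alpha> (of_real (- a')) + kernel_primitive2 \<alpha> (of_real 0)) ?F"
    by (intro tendsto_add tendsto_diff G tendsto_add_zero h')
  moreover have "eventually (\<lambda>p. p \<in> ?S) ?F"
    unfolding heights_to_zero_def by (rule filter_leD[OF inf_le1]) (simp add: eventually_principal)
  then have "eventually (\<lambda>p. ?D p = (case p of (\<gamma>, \<gamma>') \<Rightarrow> double_integral \<alpha> \<gamma> \<gamma>')) ?F"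
  proof eventually_elim
    case (elim p)
    obtain \<gamma> \<gamma>' where p: "p = (\<gamma>, \<gamma>')" "upper_path \<gamma>" "upper_path \<gamma>'"
      "Re (pathstart \<gamma>) = 0" "Re (pathfinish \<gamma>) = a" "Re (pathstart \<gamma>') = 0" "Re (pathfinish \<gamma>') = a'"
      using elim by auto
    have "pathfinish \<gamma> - cnj (pathfinish \<gamma>') = of_real (a - a') + \<i> * of_real (?b1 p + ?c1 p)"
      "pathfinish \<gamma> - cnj (pathstart \<gamma>') = of_real a + \<i> * of_real (?b1 p + ?c0 p)"
      "pathstart \<gamma> - cnj (pathfinish \<gamma>') = of_real (- a') + \<i> * of_real (?b0 p + ?c1 p)"
      "pathstart \<gamma> - cnj (pathstart \<gamma>') = of_real 0 + \<i> * of_real (?b0 p + ?c0 p)"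
      using p by (simp_all add: complex_eq_iff)
    then show ?case
      using double_integral_closed_form[OF assms p(2,3)] p(1) by (simp add: mixed_difference_def)
  qed
  ultimately have "((\<lambda>(\<gamma>, \<gamma>'). double_integral \<alpha> \<gamma> \<gamma>') \<longlongrightarrow>
     kernel_primitive2 \<alpha> (of_real (a - a')) - kernel_primitive2 \<alpha> (of_real a)
      - kernel_primitive2 \<alpha> (of_real (- a')) + kernel_primitive2 \<alpha> (of_real 0)) ?F"
    by (rule Lim_transform_eventually)
  then show ?thesis
    by (simp add: mixed_difference_def)
qed

lemma mixed_difference_real_endpoints:
  "mixed_difference (kernel_primitive2 \<alpha>) 0 (of_real a) 0 (of_real a') =
     (exp (\<i> * of_real (pi * \<alpha> * sgn (a' - a))) * of_real (\<bar>a' - a\<bar> powr (2 * \<alpha>))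
      - exp (- \<i> * of_real (pi * \<alpha> * sgn a)) * of_real (\<bar>a\<bar> powr (2 * \<alpha>))
      - exp (\<i> * of_real (pi * \<alpha> * sgn a')) * of_real (\<bar>a'\<bar> powr (2 * \<alpha>)))
     / of_real (2 * \<alpha> * (2 * \<alpha> - 1))"
proof -
  have "mixed_difference (kernel_primitive2 \<alpha>) 0 (of_real a) 0 (of_real a') =
      kernel_primitive2 \<alpha> (of_real (a - a')) - kernel_primitive2 \<alpha> (of_real a)
      - kernel_primitive2 \<alpha> (of_real (- a')) + kernel_primitive2 \<alpha> (of_real 0)"
    by (simp add: mixed_difference_def)
  moreover have "sgn (a - a') = - sgn (a' - a)" "\<bar>a - a'\<bar> = \<bar>a' - a\<bar>"
    by (auto simp: sgn_if)
  ultimately show ?thesis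
    by (simp only: kernel_primitive2_of_real) (simp add: diff_divide_distrib sgn_minus)
qed

lemma Re_exp_sgn:
  "Re (exp (\<i> * of_real (c * sgn x)) * of_real (\<bar>x\<bar> powr s)) = cos c * \<bar>x\<bar> powr s"
  "Re (exp (- \<i> * of_real (c * sgn x)) * of_real (\<bar>x\<bar> powr s)) = cos c * \<bar>x\<bar> powr s"
  by (cases "x = 0"; simp add: Re_exp sgn_if)+

lemma Re_mixed_difference_real_endpoints:
  assumes "\<alpha> > 0" "\<alpha> \<noteq> 1/2"
  shows "2 * Re (mixed_difference (kernel_primitive2 \<alpha>) 0 (of_real a) 0 (of_real a')) =
     2 * cos (pi * \<alpha>) / (\<alpha> * (1 - 2 * \<alpha>)) *
       ((\<bar>a\<bar> powr (2 * \<alpha>) + \<bar>a'\<bar> powr (2 * \<alpha>) - \<bar>a' - a\<bar> powr (2 * \<alpha>)) / 2)"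
proof -
  have "Re (mixed_difference (kernel_primitive2 \<alpha>) 0 (of_real a) 0 (of_real a')) =
      (cos (pi * \<alpha>) * \<bar>a' - a\<bar> powr (2 * \<alpha>) - cos (pi * \<alpha>) * \<bar>a\<bar> powr (2 * \<alpha>)
       - cos (pi * \<alpha>) * \<bar>a'\<bar> powr (2 * \<alpha>)) / (2 * \<alpha> * (2 * \<alpha> - 1))"
    unfolding mixed_difference_real_endpoints Re_divide_of_real minus_complex.sel Re_exp_sgn ..
  moreover have "2 * \<alpha> - 1 \<noteq> 0" "1 - 2 * \<alpha> \<noteq> 0" "\<alpha> \<noteq> 0"
    using assms by auto
  ultimately show ?thesis
    by (simp add: divide_simps) (simp add: algebra_simps)
qed


section \<open>The bound for equal paths\<close>

text \<open>
  On the disc of radius \<open>m / 2\<close> about \<open>m\<close> all points have modulus at least \<open>m / 2\<close>. As the exponent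
  \<open>s - 2\<close> is not positive, this bounds the second derivative of the power there.
\<close>

lemma powr_Taylor_bound:
  fixes m s :: real and z :: complex
  assumes "m > 0" "s \<le> 2" "cmod z \<le> m / 2"
  shows "cmod ((of_real m + z) powr of_real s -
           (of_real m powr of_real s + of_real s * of_real m powr (of_real s - 1) * z))
         \<le> \<bar>s * (s - 1)\<bar> * (m / 2) powr (s - 2) * (cmod z)\<^sup>2"
proof -
  let ?c = "complex_of_real m" and ?s = "complex_of_real s"
  define f where "f i x = (if i = 0 then x powr ?s else if i = Suc 0 then ?s * x powr (?s - 1)
      else ?s * ((?s - 1) * x powr (?s - 1 - 1)))" for i :: nat and x
  have not_nonpos: "x \<notin> \<real>\<^sub>\<le>\<^sub>0" and norm_ge: "cmod x \<ge> m / 2" if "x \<in> cball ?c (m / 2)" for x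
  proof -
    have *: "cmod (?c - x) \<le> m / 2"
      using that by (simp add: dist_norm)
    have "\<bar>Re (?c - x)\<bar> \<le> m / 2"
      using abs_Re_le_cmod * by (rule order_trans)
    then have "Re x \<ge> m / 2"
      unfolding minus_complex.sel Re_complex_of_real by linarith
    then show "x \<notin> \<real>\<^sub>\<le>\<^sub>0" "cmod x \<ge> m / 2"
      using assms(1) complex_Re_le_cmod[of x] by (auto simp: complex_nonpos_Reals_iff)
  qed
  have "cmod (f 0 (?c + z) - (\<Sum>i\<le>1. f i ?c * (?c + z - ?c) ^ i / fact i))
      \<le> (\<bar>s * (s - 1)\<bar> * (m / 2) powr (s - 2)) * cmod (?c + z - ?c) ^ Suc 1 / fact 1"
  proof (rule field_Taylor[where S = "cball ?c (m / 2)"])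
    fix i x assume x: "x \<in> cball ?c (m / 2)" and "i \<le> (1::nat)"
    then consider "i = 0" | "i = 1" by linarith
    then show "(f i has_field_derivative f (Suc i) x) (at x within cball ?c (m / 2))"
    proof cases
      case 1
      then show ?thesis
        using has_field_derivative_powr[OF not_nonpos[OF x], of ?s]
        by (simp add: f_def[abs_def] has_field_derivative_at_within)
    next
      case 2
      then show ?thesis
        using DERIV_cmult[OF has_field_derivative_powr[OF not_nonpos[OF x], of "?s - 1"], of ?s]
        by (simp add: f_def[abs_def] has_field_derivative_at_within)
    qed
  next
    fix x assume x: "x \<in> cball ?c (m / 2)"
    have "f (Suc 1) x = of_real (s * (s - 1)) * x powr of_real (s - 2)"
      by (simp add: f_def mult.assoc diff_diff_eq)
    moreover have "cmod (x powr of_real (s - 2)) = cmod x powr (s - 2)"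
      by (subst norm_powr_real_powr') auto
    ultimately have "cmod (f (Suc 1) x) = \<bar>s * (s - 1)\<bar> * cmod x powr (s - 2)"
      by (simp only: norm_mult norm_of_real)
    also have "\<dots> \<le> \<bar>s * (s - 1)\<bar> * (m / 2) powr (s - 2)"
      using norm_ge[OF x] assms by (intro mult_left_mono powr_mono2') auto
    finally show "cmod (f (Suc 1) x) \<le> \<bar>s * (s - 1)\<bar> * (m / 2) powr (s - 2)" .
  qed (use assms in \<open>auto simp: dist_norm\<close>)
  then show ?thesis
    by (simp add: f_def power2_eq_square)
qed

text \<open>
  Taking the difference of two symmetric second differences at the same point cancels the terms of
  order \<open>0\<close> and \<open>1\<close>.
\<close>

lemma powr_second_differences_bound:
  fixes m s h :: real and x y :: complex
  assumes "m > 0" "s \<le> 2" "cmod x \<le> h" "cmod y \<le> h" "h \<le> m / 2"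
  shows "cmod ((of_real m + x) powr of_real s + (of_real m - x) powr of_real s
             - (of_real m + y) powr of_real s - (of_real m - y) powr of_real s)
         \<le> 4 * (\<bar>s * (s - 1)\<bar> * (m / 2) powr (s - 2) * h\<^sup>2)"
proof -
  define R where "R z = (of_real m + z) powr of_real s -
      (of_real m powr of_real s + of_real s * of_real m powr (of_real s - 1) * z)" for z :: complex
  have R: "cmod (R z) \<le> \<bar>s * (s - 1)\<bar> * (m / 2) powr (s - 2) * h\<^sup>2" if "cmod z \<le> h" for z
  proof -
    have "cmod (R z) \<le> \<bar>s * (s - 1)\<bar> * (m / 2) powr (s - 2) * (cmod z)\<^sup>2"
      unfolding R_def using assms that by (intro powr_Taylor_bound) auto
    also have "\<dots> \<le> \<bar>s * (s - 1)\<bar> * (m / 2) powr (s - 2) * h\<^sup>2"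
      using that by (intro mult_left_mono power_mono) auto
    finally show ?thesis .
  qed
  have "(of_real m + x) powr of_real s + (of_real m - x) powr of_real s
      - (of_real m + y) powr of_real s - (of_real m - y) powr of_real s
      = R x + R (- x) - R y - R (- y)"
    by (simp add: R_def)
  also have "cmod \<dots> \<le> cmod (R x) + cmod (R (- x)) + cmod (R y) + cmod (R (- y))"
    by (meson norm_triangle_ineq norm_triangle_ineq4 order_trans add_mono order_refl)
  also have "\<dots> \<le> 4 * (\<bar>s * (s - 1)\<bar> * (m / 2) powr (s - 2) * h\<^sup>2)"
    using R[of x] R[of "- x"] R[of y] R[of "- y"] assms by simp
  finally show ?thesis .
qed

text \<open>
  Both sides are homogeneous of degree \<open>2 * \<alpha>\<close> in \<open>(z0, z1)\<close>, so what matters is the ratio \<open>m / h\<close>;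
  the two cases below treat its large and its small values. The summand \<open>4\<close> of the constant comes
  from the former; the latter contributes \<open>4\<close> terms with bases of modulus at most \<open>m + h \<le> 3 * h\<close>.
\<close>

lemma mixed_difference_conjugate_bound:
  assumes \<alpha>: "0 < \<alpha>" "\<alpha> < 1" "\<alpha> \<noteq> 1/2" and z: "Im z0 \<ge> 0" "Im z1 \<ge> 0"
  shows "cmod (mixed_difference (kernel_primitive2 \<alpha>) z0 z1 (cnj z0) (cnj z1))
     \<le> (4 + 4 * 3 powr (2 * \<alpha>) / \<bar>2 * \<alpha> * (2 * \<alpha> - 1)\<bar>) * cmod (z1 - z0) powr (2 * \<alpha>)"
proof -
  define h m where "h = cmod (z1 - z0)" and "m = Im z0 + Im z1"
  define x y where "x = complex_of_real (Im z1 - Im z0)" and "y = \<i> * complex_of_real (Re z1 - Re z0)"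
  define N where "N = (of_real m + x) powr of_real (2 * \<alpha>) + (of_real m - x) powr of_real (2 * \<alpha>)
      - (of_real m + y) powr of_real (2 * \<alpha>) - (of_real m - y) powr of_real (2 * \<alpha>)"
  have args: "- \<i> * (z1 - cnj z1) = of_real m + x" "- \<i> * (z0 - cnj z0) = of_real m - x"
    "- \<i> * (z0 - cnj z1) = of_real m + y" "- \<i> * (z1 - cnj z0) = of_real m - y"
    by (simp_all add: complex_eq_iff m_def x_def y_def)
  have D: "mixed_difference (kernel_primitive2 \<alpha>) z0 z1 (cnj z0) (cnj z1)
      = N / of_real (2 * \<alpha> * (2 * \<alpha> - 1))"
    unfolding mixed_difference_def kernel_primitive2_def args N_def
    by (simp add: diff_divide_distrib add_divide_distrib)
  have "0 \<le> h" "0 \<le> m"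
    using z by (simp_all add: h_def m_def)
  have xy: "cmod x \<le> h" "cmod y \<le> h"
    using abs_Im_le_cmod[of "z1 - z0"] abs_Re_le_cmod[of "z1 - z0"]
    by (simp_all only: x_def y_def h_def norm_mult norm_of_real norm_ii mult_1 minus_complex.sel)
  have k: "\<bar>2 * \<alpha> * (2 * \<alpha> - 1)\<bar> > 0"
    using \<alpha> by simp
  define K where "K = 4 * 3 powr (2 * \<alpha>) / \<bar>2 * \<alpha> * (2 * \<alpha> - 1)\<bar>"
  have K: "K \<ge> 0"
    by (simp add: K_def)
  have "cmod (N / of_real (2 * \<alpha> * (2 * \<alpha> - 1))) \<le> (4 + K) * h powr (2 * \<alpha>)"
  proof (cases "h = 0")
    case True
    then have "N = 0"
      using xy by (simp add: N_def)
    then show ?thesis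
      using True by simp
  next
    case False
    with \<open>0 \<le> h\<close> have h: "h > 0"
      by simp
    show ?thesis
    proof (cases "2 * h \<le> m")
      case True
      have "cmod N \<le> 4 * (\<bar>2 * \<alpha> * (2 * \<alpha> - 1)\<bar> * (m / 2) powr (2 * \<alpha> - 2) * h\<^sup>2)"
        unfolding N_def using True h \<alpha> xy by (intro powr_second_differences_bound) auto
      also have "\<dots> \<le> 4 * (\<bar>2 * \<alpha> * (2 * \<alpha> - 1)\<bar> * h powr (2 * \<alpha> - 2) * h\<^sup>2)"
        using True h \<alpha> by (intro mult_left_mono mult_right_mono powr_mono2') auto
      also have "\<dots> = \<bar>2 * \<alpha> * (2 * \<alpha> - 1)\<bar> * (4 * h powr (2 * \<alpha>))"
        using h by (simp add: powr_diff)
      finally have "cmod N / \<bar>2 * \<alpha> * (2 * \<alpha> - 1)\<bar> \<le> 4 * h powr (2 * \<alpha>)"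
        using k by (simp add: pos_divide_le_eq mult.commute)
      also have "\<dots> \<le> (4 + K) * h powr (2 * \<alpha>)"
        using K by (intro mult_right_mono) auto
      finally show ?thesis
        by (simp only: norm_divide norm_of_real)
    next
      case False
      have P: "cmod (w powr of_real (2 * \<alpha>)) \<le> 3 powr (2 * \<alpha>) * h powr (2 * \<alpha>)"
        if "cmod w \<le> m + h" for w :: complex
      proof -
        have "cmod (w powr of_real (2 * \<alpha>)) = cmod w powr (2 * \<alpha>)"
          by (subst norm_powr_real_powr') auto
        also have "\<dots> \<le> (3 * h) powr (2 * \<alpha>)"
          using that False \<alpha> by (intro powr_mono2) auto
        finally show ?thesis
          using h by (simp add: powr_mult)
      qed
      have M: "cmod (of_real m + w) \<le> m + h" "cmod (of_real m - w) \<le> m + h" if "cmod w \<le> h" for w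
        using norm_triangle_ineq[of "of_real m" w] norm_triangle_ineq4[of "of_real m" w] that \<open>0 \<le> m\<close>
        by auto
      have "cmod N \<le> cmod ((of_real m + x) powr of_real (2 * \<alpha>))
          + cmod ((of_real m - x) powr of_real (2 * \<alpha>))
          + cmod ((of_real m + y) powr of_real (2 * \<alpha>))
          + cmod ((of_real m - y) powr of_real (2 * \<alpha>))"
        unfolding N_def by (meson norm_triangle_ineq norm_triangle_ineq4 order_trans add_mono order_refl)
      also have "\<dots> \<le> 4 * (3 powr (2 * \<alpha>) * h powr (2 * \<alpha>))"
        using P[OF M(1)[OF xy(1)]] P[OF M(2)[OF xy(1)]] P[OF M(1)[OF xy(2)]] P[OF M(2)[OF xy(2)]]
        by linarith
      finally have "cmod N / \<bar>2 * \<alpha> * (2 * \<alpha> - 1)\<bar> \<le> K * h powr (2 * \<alpha>)"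
        using k unfolding K_def by (simp add: divide_right_mono)
      also have "\<dots> \<le> (4 + K) * h powr (2 * \<alpha>)"
        by (intro mult_right_mono) auto
      finally show ?thesis
        by (simp only: norm_divide norm_of_real)
    qed
  qed
  then show ?thesis
    unfolding D K_def h_def .
qed


section \<open>Path independence, boundary limit and bound\<close>

theorem lemma1p5:
  fixes \<alpha> :: real
  assumes "0 < \<alpha>" and "\<alpha> < 1" and "\<alpha> \<noteq> 1/2"
  shows
    "((\<forall>\<gamma> \<gamma>'. upper_path \<gamma> \<and> upper_path \<gamma>' \<longrightarrow> double_integral_well_defined \<alpha> \<gamma> \<gamma>') \<and>
      (\<forall>\<gamma> \<gamma>' \<delta> \<delta>'. upper_path \<gamma> \<and> upper_path \<gamma>' \<and> upper_path \<delta> \<and> upper_path \<delta>' \<and>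
          pathstart \<delta> = pathstart \<gamma> \<and> pathfinish \<delta> = pathfinish \<gamma> \<and>
          pathstart \<delta>' = pathstart \<gamma>' \<and> pathfinish \<delta>' = pathfinish \<gamma>' \<longrightarrow>
          double_integral \<alpha> \<delta> \<delta>' = double_integral \<alpha> \<gamma> \<gamma>') \<and>
      (\<forall>\<gamma> \<gamma>' (a::real). upper_path \<gamma> \<and> upper_path \<gamma>' \<longrightarrow>
          double_integral \<alpha> (\<lambda>t. \<gamma> t + of_real a) (\<lambda>t. \<gamma>' t + of_real a) = double_integral \<alpha> \<gamma> \<gamma>')) \<and>
     (\<forall>(a2::real) (a2'::real).
        ((\<lambda>(\<gamma>, \<gamma>'). double_integral \<alpha> \<gamma> \<gamma>') \<longlongrightarrow>
           (exp (\<i> * of_real (pi * \<alpha> * sgn (a2' - a2))) * of_real (\<bar>a2' - a2\<bar> powr (2 * \<alpha>))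
            - exp (- \<i> * of_real (pi * \<alpha> * sgn a2)) * of_real (\<bar>a2\<bar> powr (2 * \<alpha>))
            - exp (\<i> * of_real (pi * \<alpha> * sgn a2')) * of_real (\<bar>a2'\<bar> powr (2 * \<alpha>)))
           / of_real (2 * \<alpha> * (2 * \<alpha> - 1))) (heights_to_zero a2 a2') \<and>
        (\<forall>\<gamma> \<gamma>'. double_integral \<alpha> \<gamma> \<gamma>' + cnj (double_integral \<alpha> \<gamma> \<gamma>')
                 = of_real (2 * Re (double_integral \<alpha> \<gamma> \<gamma>'))) \<and>
        ((\<lambda>(\<gamma>, \<gamma>'). 2 * Re (double_integral \<alpha> \<gamma> \<gamma>')) \<longlongrightarrow>
           2 * cos (pi * \<alpha>) / (\<alpha> * (1 - 2 * \<alpha>)) *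
           ((\<bar>a2\<bar> powr (2 * \<alpha>) + \<bar>a2'\<bar> powr (2 * \<alpha>) - \<bar>a2' - a2\<bar> powr (2 * \<alpha>)) / 2))
          (heights_to_zero a2 a2')) \<and>
     (\<exists>C>0. \<forall>\<gamma>. upper_path \<gamma> \<longrightarrow>
        norm (double_integral \<alpha> \<gamma> \<gamma>) \<le> C * norm (pathfinish \<gamma> - pathstart \<gamma>) powr (2 * \<alpha>))"
proof (intro conjI allI impI)
  have \<alpha>: "\<alpha> > 0" "\<alpha> \<noteq> 1/2"
    using assms by auto
  note closed_form = double_integral_closed_form[OF \<alpha>]
  fix \<gamma> \<gamma>'
  show "upper_path \<gamma> \<and> upper_path \<gamma>' \<Longrightarrow> double_integral_well_defined \<alpha> \<gamma> \<gamma>'"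
    using double_integral_well_definedI[OF \<alpha>] by blast
  show "double_integral \<alpha> \<delta> \<delta>' = double_integral \<alpha> \<gamma> \<gamma>'"
    if "upper_path \<gamma> \<and> upper_path \<gamma>' \<and> upper_path \<delta> \<and> upper_path \<delta>' \<and>
      pathstart \<delta> = pathstart \<gamma> \<and> pathfinish \<delta> = pathfinish \<gamma> \<and>
      pathstart \<delta>' = pathstart \<gamma>' \<and> pathfinish \<delta>' = pathfinish \<gamma>'" for \<delta> \<delta>'
    using that by (simp add: closed_form)
  show "double_integral \<alpha> (\<lambda>t. \<gamma> t + of_real a) (\<lambda>t. \<gamma>' t + of_real a) = double_integral \<alpha> \<gamma> \<gamma>'"
    if "upper_path \<gamma> \<and> upper_path \<gamma>'" for a
    using that
    by (simp add: closed_form upper_path_translate mixed_difference_def pathstart_def pathfinish_def)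
  show "double_integral \<alpha> \<gamma> \<gamma>' + cnj (double_integral \<alpha> \<gamma> \<gamma>')
      = of_real (2 * Re (double_integral \<alpha> \<gamma> \<gamma>'))"
    by (rule complex_add_cnj)
next
  fix a2 a2' :: real
  have \<alpha>: "\<alpha> > 0" "\<alpha> \<noteq> 1/2"
    using assms by auto
  note limit = double_integral_limit[OF \<alpha>, of a2 a2']
  show "((\<lambda>(\<gamma>, \<gamma>'). double_integral \<alpha> \<gamma> \<gamma>') \<longlongrightarrow>
           (exp (\<i> * of_real (pi * \<alpha> * sgn (a2' - a2))) * of_real (\<bar>a2' - a2\<bar> powr (2 * \<alpha>))
            - exp (- \<i> * of_real (pi * \<alpha> * sgn a2)) * of_real (\<bar>a2\<bar> powr (2 * \<alpha>))
            - exp (\<i> * of_real (pi * \<alpha> * sgn a2')) * of_real (\<bar>a2'\<bar> powr (2 * \<alpha>)))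
           / of_real (2 * \<alpha> * (2 * \<alpha> - 1))) (heights_to_zero a2 a2')"
    using limit unfolding mixed_difference_real_endpoints .
  show "((\<lambda>(\<gamma>, \<gamma>'). 2 * Re (double_integral \<alpha> \<gamma> \<gamma>')) \<longlongrightarrow>
           2 * cos (pi * \<alpha>) / (\<alpha> * (1 - 2 * \<alpha>)) *
           ((\<bar>a2\<bar> powr (2 * \<alpha>) + \<bar>a2'\<bar> powr (2 * \<alpha>) - \<bar>a2' - a2\<bar> powr (2 * \<alpha>)) / 2))
          (heights_to_zero a2 a2')"
    using tendsto_mult_left[OF tendsto_Re[OF limit], of 2]
    unfolding Re_mixed_difference_real_endpoints[OF \<alpha>] by (simp add: case_prod_unfold)
next
  let ?C = "4 + 4 * 3 powr (2 * \<alpha>) / \<bar>2 * \<alpha> * (2 * \<alpha> - 1)\<bar>"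
  have "?C > 0"
    by (intro add_pos_nonneg) auto
  moreover have "norm (double_integral \<alpha> \<gamma> \<gamma>) \<le> ?C * norm (pathfinish \<gamma> - pathstart \<gamma>) powr (2 * \<alpha>)"
    if "upper_path \<gamma>" for \<gamma>
    using mixed_difference_conjugate_bound[OF assms upper_pathD(3,4)[OF that]] assms that
    by (simp add: double_integral_closed_form)
  ultimately show "\<exists>C>0. \<forall>\<gamma>. upper_path \<gamma> \<longrightarrow>
      norm (double_integral \<alpha> \<gamma> \<gamma>) \<le> C * norm (pathfinish \<gamma> - pathstart \<gamma>) powr (2 * \<alpha>)"
    by blast
qed

end
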